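(* Let $\lambda>0$. For each $n$ let $(B_{n,k})_{1\le k\le N_n}$ be independent $\{0,1\}$-valued Bernoulli variables with success probabilities $p_{n,k}$, and put $X_n:=\sum_{k=1}^{N_n}B_{n,k}$ and $\theta_n:=\mathbb E[X_n]=\sum_{k=1}^{N_n}p_{n,k}$. If $\theta_n\to\lambda$ and $\max_{1\le k\le N_n}p_{n,k}\to0$, then $X_n$ converges to $\mathrm{Poisson}(\lambda)$ in total variation and its first four moments converge to those of the limit.
   Context: Total-variation convergence refers to $d_{\mathrm{TV}}(X,Y)=\sup_{A\subseteq\mathbb N_0}|\mathbb P(X\in A)-\mathbb P(Y\in A)|$ for random variables with values in $\mathbb N_0=\{0,1,2,\dots\}$. *)

theory Defs
  imports "HOL-Probability.Probability"
begin

(* The two random variables may live on different probability spaces. For probability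
   measures and measurable X, Y the set of values is bounded by 1, so the real-valued
   supremum is the true one. *)
definition tv_dist ::
  "'a measure \<Rightarrow> ('a \<Rightarrow> nat) \<Rightarrow> 'b measure \<Rightarrow> ('b \<Rightarrow> nat) \<Rightarrow> real" where
  "tv_dist M X N Y =
     (SUP A::nat set. \<bar>measure M {\<omega> \<in> space M. X \<omega> \<in> A} - measure N {\<omega> \<in> space N. Y \<omega> \<in> A}\<bar>)"

end

theory Submission
  imports Defs
begin

text \<open>
  Everything follows from two estimates on the point masses of a sum $S$ of independent
  Bernoulli variables with success probabilities $p_k$, where $s = \sum_k p_k$:
  \[ P(S = j) \le \frac{s^j}{j!}, \qquad
     \Bigl| P(S = j) - e^{-s} \frac{s^j}{j!} \Bigr| \le 2 \sum_k p_k^2 . \]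
  Both are proved by adding one variable at a time (\<open>bernoulli_sum_bounds\<close>). A new variable
  with success probability $p$ replaces the vector of point masses $a$ by
  $(1-p)\, a_j + p\, a_{j-1}$. This averaging does not increase the supremum distance, and since
  the Poisson weights satisfy $\frac{d}{ds} \pi_s(j) = \pi_s(j-1) - \pi_s(j)$, it agrees with the
  replacement of $\pi_s$ by $\pi_{s+p}$ up to an error of second order in $p$
  (\<open>poisson_weight_bernoulli_step\<close>). The errors add up to $2 \sum_k p_k^2$.

  For the array, $\sum_k p_{n,k}^2 \le \theta_n \max_k p_{n,k} \to 0$, so the second estimate gives
  convergence of every single point mass to the Poisson one. As $\theta_n$ is bounded by some $C$,
  the first estimate dominates all point masses by $C^j / j!$, which remains summable after
  multiplication by any power of $j$. Dominated convergence then yields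
  \[ \sum_j j^r \, | P(X_n = j) - \pi_\lambda(j) | \to 0 \]
  for every $r$ (\<open>weighted_l1_tendsto_0\<close>). The case $r = 0$ bounds the total variation distance, and
  the sum for general $r$ bounds the difference of the $r$-th moments
  (\<open>expectation_diff_le_weighted_l1\<close>).
\<close>

section \<open>Poisson weights\<close>

definition poisson_weight :: "real \<Rightarrow> nat \<Rightarrow> real" where
  "poisson_weight s j = s ^ j / fact j * exp (- s)"

text \<open>
  With the value 0 at 0, this is the map of point masses induced by adding 1 to a variable, so that
  the formulas with index $j - 1$ hold at $j = 0$ as well.
\<close>
definition shift_one :: "(nat \<Rightarrow> real) \<Rightarrow> nat \<Rightarrow> real" where
  "shift_one a j = (case j of 0 \<Rightarrow> 0 | Suc i \<Rightarrow> a i)"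

lemma shift_one_simps [simp]: "shift_one a 0 = 0" "shift_one a (Suc i) = a i"
  by (simp_all add: shift_one_def)

lemma abs_shift_one_diff_le:
  assumes "\<And>i. \<bar>a i - b i\<bar> \<le> c"
  shows "\<bar>shift_one a j - shift_one b j\<bar> \<le> c"
proof (cases j)
  case 0
  have "0 \<le> c"
    using assms[of 0] by linarith
  then show ?thesis
    using 0 by simp
qed (simp add: assms)

lemma poisson_weight_nonneg: "0 \<le> s \<Longrightarrow> 0 \<le> poisson_weight s j"
  by (simp add: poisson_weight_def)

lemma pmf_poisson_eq_weight: "0 < s \<Longrightarrow> pmf (poisson_pmf s) j = poisson_weight s j"
  by (simp add: poisson_weight_def)

lemma poisson_weight_le_1:
  assumes "0 \<le> s"
  shows "poisson_weight s j \<le> 1"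
proof (cases "s = 0")
  case True
  then show ?thesis
    by (cases j) (simp_all add: poisson_weight_def)
next
  case False
  then show ?thesis
    using assms pmf_le_1[of "poisson_pmf s" j] pmf_poisson_eq_weight[of s j]
    by (simp del: pmf_poisson)
qed

lemma poisson_weight_has_derivative:
  "((\<lambda>s. poisson_weight s j) has_real_derivative
     (shift_one (poisson_weight s) j - poisson_weight s j)) (at s within S)"
proof (cases j)
  case 0
  then show ?thesis
    unfolding poisson_weight_def by (auto intro!: derivative_eq_intros)
next
  case (Suc i)
  have "((\<lambda>s. s ^ Suc i / fact (Suc i) * exp (- s)) has_real_derivative
      real (Suc i) * s ^ i / fact (Suc i) * exp (- s) - s ^ Suc i / fact (Suc i) * exp (- s)) (at s within S)"
    by (auto intro!: derivative_eq_intros simp: diff_divide_distrib mult.commute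
          simp del: fact_Suc of_nat_Suc power_Suc)
  also have "real (Suc i) * s ^ i / fact (Suc i) = s ^ i / fact i"
    by (simp del: of_nat_Suc)
  finally show ?thesis
    by (simp add: poisson_weight_def Suc del: fact_Suc power_Suc)
qed

lemma shift_one_poisson_weight_has_derivative:
  "((\<lambda>s. shift_one (poisson_weight s) j) has_real_derivative
     (shift_one (\<lambda>i. shift_one (poisson_weight s) i - poisson_weight s i) j)) (at s within S)"
  by (cases j) (simp_all add: poisson_weight_has_derivative)

text \<open>
  The comparison term is the first-order Taylor polynomial in $p$ of the Poisson weight at $s + p$,
  because the derivative in $s$ is $\pi_s(j-1) - \pi_s(j)$. The second derivative has the same form
  with this difference, which lies in $[-1, 1]$, in place of $\pi_s$, and hence is at most 2 in
  absolute value.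
\<close>
lemma poisson_weight_bernoulli_step:
  assumes "0 \<le> s" "0 \<le> p"
  shows "\<bar>poisson_weight (s + p) j
           - ((1 - p) * poisson_weight s j + p * shift_one (poisson_weight s) j)\<bar> \<le> 2 * p\<^sup>2"
proof -
  define D where "D = (\<lambda>x i. shift_one (poisson_weight x) i - poisson_weight x i)"
  have D_le: "\<bar>D x i\<bar> \<le> 1" if "0 \<le> x" for x i
    using poisson_weight_nonneg[OF that, of i] poisson_weight_le_1[OF that, of i]
      poisson_weight_nonneg[OF that, of "i - 1"] poisson_weight_le_1[OF that, of "i - 1"]
    by (cases i) (simp_all add: D_def abs_le_iff)
  have D_deriv: "((\<lambda>x. D x j) has_real_derivative (shift_one (D x) j - D x j)) (at x within {0..})" for x
    unfolding D_def
    by (rule DERIV_diff poisson_weight_has_derivative shift_one_poisson_weight_has_derivative)+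
  have D_lip: "\<bar>D x j - D s j\<bar> \<le> 2 * \<bar>x - s\<bar>" if "0 \<le> x" for x
  proof (rule field_differentiable_bound[of "{0..}" "\<lambda>x. D x j" "\<lambda>x. shift_one (D x) j - D x j" 2 x s,
        unfolded real_norm_def])
    show "\<bar>shift_one (D y) j - D y j\<bar> \<le> 2" if "y \<in> {0..}" for y
      using that D_le[of y j] D_le[of y "j - 1"] by (cases j) (simp_all add: abs_le_iff)
  qed (use that assms D_deriv in auto)
  \<comment> \<open>\<open>h\<close> is the weight minus its tangent at \<open>s\<close>; its derivative is small by the Lipschitz bound.\<close>
  define h where "h = (\<lambda>x. poisson_weight x j - (x - s) * D s j)"
  have "\<bar>h (s + p) - h s\<bar> \<le> (2 * p) * \<bar>(s + p) - s\<bar>"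
  proof (rule field_differentiable_bound[of "{s..s+p}" h "\<lambda>x. D x j - D s j" "2 * p" "s + p" s,
        unfolded real_norm_def])
    show "(h has_real_derivative (D x j - D s j)) (at x within {s..s+p})" for x
      unfolding h_def D_def
      by (auto intro!: derivative_eq_intros poisson_weight_has_derivative)
    show "\<bar>D x j - D s j\<bar> \<le> 2 * p" if "x \<in> {s..s+p}" for x
      using D_lip[of x] that assms by simp
  qed (use assms in auto)
  then show ?thesis
    using assms by (simp add: h_def D_def power2_eq_square algebra_simps)
qed

section \<open>Sums of independent Bernoulli variables\<close>

lemma (in prob_space) bernoulli_sum_prob_insert:
  fixes B :: "'i \<Rightarrow> 'a \<Rightarrow> nat"
  assumes I: "finite I" "i \<notin> I"
    and indep: "indep_vars (\<lambda>_. count_space UNIV) B (insert i I)"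
    and values01: "\<And>\<omega>. \<omega> \<in> space M \<Longrightarrow> B i \<omega> \<in> {0, 1}"
    and success: "prob {\<omega> \<in> space M. B i \<omega> = 1} = p"
  shows "prob {\<omega> \<in> space M. (\<Sum>k\<in>insert i I. B k \<omega>) = j} =
    (1 - p) * prob {\<omega> \<in> space M. (\<Sum>k\<in>I. B k \<omega>) = j}
      + p * shift_one (\<lambda>j. prob {\<omega> \<in> space M. (\<Sum>k\<in>I. B k \<omega>) = j}) j"
proof -
  define S where "S = (\<lambda>\<omega>. \<Sum>k\<in>I. B k \<omega>)"
  have meas: "B k \<in> M \<rightarrow>\<^sub>M count_space UNIV" if "k \<in> insert i I" for k
    using indep that unfolding indep_vars_def by auto
  have [measurable]: "B i \<in> M \<rightarrow>\<^sub>M count_space UNIV" using meas by blast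
  have "(\<lambda>\<omega>. \<Sum>k\<in>I. B k \<omega>) \<in> M \<rightarrow>\<^sub>M count_space UNIV"
    by (rule measurable_sum_nat) (use meas in auto)
  then have [measurable]: "S \<in> M \<rightarrow>\<^sub>M count_space UNIV"
    by (simp add: S_def)
  have "indep_vars (\<lambda>_. borel) (\<lambda>k \<omega>. real (B k \<omega>)) (insert i I)"
    by (rule indep_vars_compose2[OF indep]) simp
  from indep_vars_sum[OF I this]
  have ind: "indep_var borel (\<lambda>\<omega>. real (B i \<omega>)) borel (\<lambda>\<omega>. real (S \<omega>))"
    by (simp add: S_def)
  have joint: "prob {\<omega> \<in> space M. B i \<omega> = b \<and> S \<omega> = m} =
      prob {\<omega> \<in> space M. B i \<omega> = b} * prob {\<omega> \<in> space M. S \<omega> = m}" for b m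
    using indep_varD[OF ind, of "{real b}" "{real m}"]
    by (simp add: vimage_def Int_def conj_commute)
  have "prob {\<omega> \<in> space M. B i \<omega> = 0} = prob (space M - {\<omega> \<in> space M. B i \<omega> = 1})"
    using values01 by (intro arg_cong[where f = prob]) fastforce
  also have "\<dots> = 1 - p"
    using success by (subst prob_compl) auto
  finally have failure: "prob {\<omega> \<in> space M. B i \<omega> = 0} = 1 - p" .
  have "prob {\<omega> \<in> space M. B i \<omega> + S \<omega> = j} =
      prob ({\<omega> \<in> space M. B i \<omega> = 0 \<and> S \<omega> = j} \<union> {\<omega> \<in> space M. B i \<omega> = 1 \<and> Suc (S \<omega>) = j})"
    using values01 by (intro arg_cong[where f = prob]) fastforce
  also have "\<dots> = prob {\<omega> \<in> space M. B i \<omega> = 0 \<and> S \<omega> = j}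
      + prob {\<omega> \<in> space M. B i \<omega> = 1 \<and> Suc (S \<omega>) = j}"
    by (intro finite_measure_Union) auto
  also have "prob {\<omega> \<in> space M. B i \<omega> = 1 \<and> Suc (S \<omega>) = j} =
      p * shift_one (\<lambda>j. prob {\<omega> \<in> space M. S \<omega> = j}) j"
    using joint success by (cases j) auto
  finally show ?thesis
    using I joint failure by (simp add: S_def)
qed

text \<open>The two terms on the left are the leading ones of the binomial expansion.\<close>
lemma power_Suc_first_order:
  fixes s p :: real
  assumes "0 \<le> s" "0 \<le> p"
  shows "s ^ Suc m + real (Suc m) * p * s ^ m \<le> (s + p) ^ Suc m"
proof (induction m)
  case (Suc m)
  have "s ^ Suc (Suc m) + real (Suc (Suc m)) * p * s ^ Suc m + real (Suc m) * p\<^sup>2 * s ^ m =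
      (s + p) * (s ^ Suc m + real (Suc m) * p * s ^ m)"
    by (simp add: algebra_simps power2_eq_square)
  also have "\<dots> \<le> (s + p) * (s + p) ^ Suc m"
    using assms by (intro mult_left_mono Suc.IH) simp
  finally show ?case
    using assms by (smt (verit) mult_nonneg_nonneg of_nat_0_le_iff power_Suc zero_le_power)
qed simp

text \<open>
  The first bound is the union bound over the $j$-element sets of variables that are all 1, in
  a form that suits the induction: $s^j/j! + p\, s^{j-1}/(j-1)! \le (s+p)^j/j!$. In the second,
  averaging with weights $1-p$ and $p$ preserves the error made so far, and each new variable adds
  the Taylor error $2 p^2$.
\<close>
lemma (in prob_space) bernoulli_sum_bounds:
  fixes B :: "'i \<Rightarrow> 'a \<Rightarrow> nat"
  assumes "finite I"
    and "indep_vars (\<lambda>_. count_space UNIV) B I"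
    and "\<And>k \<omega>. k \<in> I \<Longrightarrow> \<omega> \<in> space M \<Longrightarrow> B k \<omega> \<in> {0, 1}"
    and "\<And>k. k \<in> I \<Longrightarrow> prob {\<omega> \<in> space M. B k \<omega> = 1} = p k"
  shows bernoulli_sum_prob_le:
      "prob {\<omega> \<in> space M. (\<Sum>k\<in>I. B k \<omega>) = j} \<le> (\<Sum>k\<in>I. p k) ^ j / fact j"
    and bernoulli_sum_prob_near_poisson:
      "\<bar>prob {\<omega> \<in> space M. (\<Sum>k\<in>I. B k \<omega>) = j} - poisson_weight (\<Sum>k\<in>I. p k) j\<bar>
        \<le> 2 * (\<Sum>k\<in>I. (p k)\<^sup>2)"
proof -
  \<comment> \<open>The recursion links \<open>j\<close> with its predecessor, hence the quantifier over \<open>j\<close>.\<close>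
  have "(\<forall>j. prob {\<omega> \<in> space M. (\<Sum>k\<in>I. B k \<omega>) = j} \<le> (\<Sum>k\<in>I. p k) ^ j / fact j) \<and>
    (\<forall>j. \<bar>prob {\<omega> \<in> space M. (\<Sum>k\<in>I. B k \<omega>) = j} - poisson_weight (\<Sum>k\<in>I. p k) j\<bar>
        \<le> 2 * (\<Sum>k\<in>I. (p k)\<^sup>2))"
    using assms
  proof (induction I rule: finite_induct)
    case empty
    have "prob {\<omega> \<in> space M. j = 0} = (if j = 0 then 1 else 0)" for j :: nat
      by (simp add: prob_space)
    then show ?case
      by (auto simp: poisson_weight_def power_0_left)
  next
    case (insert i I)
    define q where "q = (\<lambda>j. prob {\<omega> \<in> space M. (\<Sum>k\<in>I. B k \<omega>) = j})"
    define s where "s = (\<Sum>k\<in>I. p k)"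
    have "p k = prob {\<omega> \<in> space M. B k \<omega> = 1}" if "k \<in> insert i I" for k
      using insert.prems(3)[OF that] ..
    then have p: "0 \<le> p k" "p k \<le> 1" if "k \<in> insert i I" for k
      using that by simp_all
    have s0: "0 \<le> s"
      unfolding s_def by (intro sum_nonneg p) simp
    have "indep_vars (\<lambda>_. count_space UNIV) B I"
      using insert.prems(1) by (rule indep_vars_subset) auto
    with insert.IH insert.prems
    have q_le: "q j \<le> s ^ j / fact j"
      and q_near: "\<bar>q j - poisson_weight s j\<bar> \<le> 2 * (\<Sum>k\<in>I. (p k)\<^sup>2)" for j
      by (auto simp: q_def s_def)
    have rec: "prob {\<omega> \<in> space M. (\<Sum>k\<in>insert i I. B k \<omega>) = j} = (1 - p i) * q j + p i * shift_one q j" for j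
      unfolding q_def
      by (rule bernoulli_sum_prob_insert) (use insert.hyps insert.prems in auto)
    have sum_p: "(\<Sum>k\<in>insert i I. p k) = s + p i"
      and sum_p2: "(\<Sum>k\<in>insert i I. (p k)\<^sup>2) = (\<Sum>k\<in>I. (p k)\<^sup>2) + (p i)\<^sup>2"
      using insert.hyps by (simp_all add: s_def)
    have pi: "0 \<le> p i" "p i \<le> 1"
      using p by simp_all
    have le: "(1 - p i) * q j + p i * shift_one q j \<le> (s + p i) ^ j / fact j" for j
    proof (cases j)
      case 0
      then show ?thesis
        using q_le[of 0] pi by (simp add: mult_le_one q_def)
    next
      case (Suc m)
      have q_nonneg: "0 \<le> q j"
        by (simp add: q_def)
      have "(1 - p i) * q j + p i * q m \<le> q j + p i * q m"
        using pi q_nonneg by (simp add: mult_left_le_one_le)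
      also have "\<dots> \<le> s ^ j / fact j + p i * (s ^ m / fact m)"
        using pi by (intro add_mono mult_left_mono q_le) auto
      also have "\<dots> = (s ^ Suc m + real (Suc m) * p i * s ^ m) / fact j"
        by (simp add: Suc add_divide_distrib del: of_nat_Suc power_Suc)
      also have "\<dots> \<le> (s + p i) ^ Suc m / fact j"
        by (rule divide_right_mono[OF power_Suc_first_order]) (use s0 pi in auto)
      finally show ?thesis
        by (simp add: Suc)
    qed
    have near: "\<bar>(1 - p i) * q j + p i * shift_one q j - poisson_weight (s + p i) j\<bar>
        \<le> 2 * ((\<Sum>k\<in>I. (p k)\<^sup>2) + (p i)\<^sup>2)" for j
    proof -
      define c where "c = 2 * (\<Sum>k\<in>I. (p k)\<^sup>2)"
      define W where "W = poisson_weight s"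
      have "\<bar>(1 - p i) * (q j - W j) + p i * (shift_one q j - shift_one W j)\<bar>
          \<le> \<bar>(1 - p i) * (q j - W j)\<bar> + \<bar>p i * (shift_one q j - shift_one W j)\<bar>"
        by (rule abs_triangle_ineq)
      also have "\<dots> \<le> (1 - p i) * c + p i * c"
        unfolding abs_mult using pi q_near abs_shift_one_diff_le[of q W c]
        by (intro add_mono mult_mono) (auto simp: c_def W_def)
      finally have "\<bar>(1 - p i) * (q j - W j) + p i * (shift_one q j - shift_one W j)\<bar> \<le> c"
        by (simp add: algebra_simps)
      with poisson_weight_bernoulli_step[OF s0 pi(1), of j] show ?thesis
        unfolding c_def W_def by (simp add: algebra_simps abs_le_iff)
    qed
    show ?case
      unfolding rec sum_p sum_p2 using le near by blast
  qed
  then show "prob {\<omega> \<in> space M. (\<Sum>k\<in>I. B k \<omega>) = j} \<le> (\<Sum>k\<in>I. p k) ^ j / fact j"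
    and "\<bar>prob {\<omega> \<in> space M. (\<Sum>k\<in>I. B k \<omega>) = j} - poisson_weight (\<Sum>k\<in>I. p k) j\<bar>
        \<le> 2 * (\<Sum>k\<in>I. (p k)\<^sup>2)"
    by auto
qed

lemma (in prob_space) bernoulli_sum_mean:
  fixes B :: "'i \<Rightarrow> 'a \<Rightarrow> nat"
  assumes meas: "\<And>k. k \<in> I \<Longrightarrow> B k \<in> M \<rightarrow>\<^sub>M count_space UNIV"
    and values01: "\<And>k \<omega>. k \<in> I \<Longrightarrow> \<omega> \<in> space M \<Longrightarrow> B k \<omega> \<in> {0, 1}"
    and success: "\<And>k. k \<in> I \<Longrightarrow> prob {\<omega> \<in> space M. B k \<omega> = 1} = p k"
  shows "expectation (\<lambda>\<omega>. real (\<Sum>k\<in>I. B k \<omega>)) = (\<Sum>k\<in>I. p k)"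
proof -
  have ind: "real (B k \<omega>) = indicator {\<omega> \<in> space M. B k \<omega> = 1} \<omega>" if "k \<in> I" "\<omega> \<in> space M" for k \<omega>
    using values01[OF that] that by (auto simp: indicator_def)
  have "expectation (\<lambda>\<omega>. real (\<Sum>k\<in>I. B k \<omega>)) =
      expectation (\<lambda>\<omega>. \<Sum>k\<in>I. indicator {\<omega> \<in> space M. B k \<omega> = 1} \<omega>)"
    by (intro Bochner_Integration.integral_cong) (auto intro!: sum.cong simp: ind)
  also have "\<dots> = (\<Sum>k\<in>I. prob {\<omega> \<in> space M. B k \<omega> = 1})"
  proof (subst Bochner_Integration.integral_sum)
    fix k assume "k \<in> I"
    note [measurable] = meas[OF this]
    have "{\<omega> \<in> space M. B k \<omega> = 1} \<in> sets M"
      by measurable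
    then show "integrable M (indicator {\<omega> \<in> space M. B k \<omega> = 1} :: 'a \<Rightarrow> real)"
      by (intro integrable_real_indicator) (auto simp: less_top[symmetric])
  qed (auto intro!: sum.cong arg_cong[where f = prob])
  also have "\<dots> = (\<Sum>k\<in>I. p k)"
    using success by simp
  finally show ?thesis .
qed

section \<open>From point masses to expectations and total variation\<close>

text \<open>
  The law of a variable with values in the natural numbers has its point masses as density with
  respect to the counting measure.
\<close>
lemma (in prob_space) nat_expectation_sums:
  fixes X :: "'a \<Rightarrow> nat" and f :: "nat \<Rightarrow> real"
  assumes X [measurable]: "X \<in> M \<rightarrow>\<^sub>M count_space UNIV"
    and summable: "summable (\<lambda>j. \<bar>f j\<bar> * prob {\<omega> \<in> space M. X \<omega> = j})"
  shows "(\<lambda>j. f j * prob {\<omega> \<in> space M. X \<omega> = j}) sums expectation (\<lambda>\<omega>. f (X \<omega>))"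
proof -
  let ?a = "\<lambda>j. prob {\<omega> \<in> space M. X \<omega> = j}"
  have distr: "distr M (count_space UNIV) X = density (count_space UNIV) ?a"
  proof (rule measure_eqI_countable[where A = UNIV])
    fix j
    have "emeasure (distr M (count_space UNIV) X) {j} = emeasure M {\<omega> \<in> space M. X \<omega> = j}"
      by (simp add: emeasure_distr vimage_def Int_def conj_commute)
    also have "\<dots> = emeasure (density (count_space UNIV) ?a) {j}"
      by (simp add: emeasure_density nn_integral_count_space_indicator emeasure_eq_measure)
    finally show "emeasure (distr M (count_space UNIV) X) {j} =
        emeasure (density (count_space UNIV) ?a) {j}" .
  qed auto
  have "expectation (\<lambda>\<omega>. f (X \<omega>)) = integral\<^sup>L (distr M (count_space UNIV) X) f"
    by (simp add: integral_distr)
  also have "\<dots> = integral\<^sup>L (count_space UNIV) (\<lambda>j. ?a j * f j)"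
    unfolding distr by (simp add: integral_density)
  finally have eq: "expectation (\<lambda>\<omega>. f (X \<omega>)) = integral\<^sup>L (count_space UNIV) (\<lambda>j. f j * ?a j)"
    by (simp add: mult.commute)
  show ?thesis
    unfolding eq
    by (rule sums_integral_count_space_nat)
      (use summable in \<open>simp add: integrable_count_space_nat_iff abs_mult\<close>)
qed

text \<open>
  With $w = 1$ this controls probabilities, with $w(j) = j^r$ it controls moments.
\<close>
lemma expectation_diff_le_weighted_l1:
  fixes X :: "'a \<Rightarrow> nat" and Y :: "'b \<Rightarrow> nat" and f w :: "nat \<Rightarrow> real"
  assumes "prob_space M" "prob_space N"
    and X: "X \<in> M \<rightarrow>\<^sub>M count_space UNIV" and Y: "Y \<in> N \<rightarrow>\<^sub>M count_space UNIV"
    and f: "\<And>j. \<bar>f j\<bar> \<le> w j"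
    and sX: "summable (\<lambda>j. w j * measure M {\<omega> \<in> space M. X \<omega> = j})"
    and sY: "summable (\<lambda>j. w j * measure N {\<omega> \<in> space N. Y \<omega> = j})"
  shows "\<bar>(\<integral>\<omega>. f (X \<omega>) \<partial>M) - (\<integral>\<omega>. f (Y \<omega>) \<partial>N)\<bar> \<le>
    (\<Sum>j. w j * \<bar>measure M {\<omega> \<in> space M. X \<omega> = j} - measure N {\<omega> \<in> space N. Y \<omega> = j}\<bar>)"
proof -
  interpret M: prob_space M by fact
  interpret N: prob_space N by fact
  let ?a = "\<lambda>j. measure M {\<omega> \<in> space M. X \<omega> = j}"
  let ?b = "\<lambda>j. measure N {\<omega> \<in> space N. Y \<omega> = j}"
  have w: "0 \<le> w j" for j
    using f[of j] by linarith
  have sl: "summable (\<lambda>j. w j * \<bar>?a j - ?b j\<bar>)"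
  proof (rule summable_comparison_test'[OF summable_add[OF sX sY]])
    show "norm (w j * \<bar>?a j - ?b j\<bar>) \<le> w j * ?a j + w j * ?b j" for j
      using w[of j] abs_triangle_ineq4[of "?a j" "?b j"]
      by (simp add: abs_mult distrib_left[symmetric] mult_left_mono)
  qed
  have "(\<lambda>j. f j * ?a j) sums (\<integral>\<omega>. f (X \<omega>) \<partial>M)"
    by (rule M.nat_expectation_sums[OF X summable_comparison_test'[OF sX]])
      (simp add: abs_mult mult_right_mono f)
  moreover have "(\<lambda>j. f j * ?b j) sums (\<integral>\<omega>. f (Y \<omega>) \<partial>N)"
    by (rule N.nat_expectation_sums[OF Y summable_comparison_test'[OF sY]])
      (simp add: abs_mult mult_right_mono f)
  ultimately have "(\<lambda>j. f j * (?a j - ?b j)) sums ((\<integral>\<omega>. f (X \<omega>) \<partial>M) - (\<integral>\<omega>. f (Y \<omega>) \<partial>N))"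
    using sums_diff by (fastforce simp: right_diff_distrib)
  then have eq: "(\<integral>\<omega>. f (X \<omega>) \<partial>M) - (\<integral>\<omega>. f (Y \<omega>) \<partial>N) = (\<Sum>j. f j * (?a j - ?b j))"
    by (simp add: sums_iff)
  have le: "norm (f j * (?a j - ?b j)) \<le> w j * \<bar>?a j - ?b j\<bar>" for j
    by (simp add: abs_mult mult_right_mono f)
  show ?thesis
    unfolding eq using norm_suminf_le[OF le sl] by simp
qed

lemma (in prob_space) prob_eq_expectation_indicator:
  fixes X :: "'a \<Rightarrow> nat"
  shows "prob {\<omega> \<in> space M. X \<omega> \<in> A} = expectation (\<lambda>\<omega>. indicator A (X \<omega>))"
proof -
  have "expectation (\<lambda>\<omega>. indicator A (X \<omega>)) = expectation (\<lambda>\<omega>. indicator {\<omega> \<in> space M. X \<omega> \<in> A} \<omega>)"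
    by (intro Bochner_Integration.integral_cong) (auto simp: indicator_def)
  also have "\<dots> = prob {\<omega> \<in> space M. X \<omega> \<in> A}"
    by (simp, rule arg_cong[where f = prob]) auto
  finally show ?thesis ..
qed

lemma tv_dist_le_l1:
  fixes X :: "'a \<Rightarrow> nat" and Y :: "'b \<Rightarrow> nat"
  assumes M: "prob_space M" and N: "prob_space N"
    and X: "X \<in> M \<rightarrow>\<^sub>M count_space UNIV"
    and Y: "Y \<in> N \<rightarrow>\<^sub>M count_space UNIV"
    and sX: "summable (\<lambda>j. measure M {\<omega> \<in> space M. X \<omega> = j})"
    and sY: "summable (\<lambda>j. measure N {\<omega> \<in> space N. Y \<omega> = j})"
  shows "tv_dist M X N Y \<le>
    (\<Sum>j. \<bar>measure M {\<omega> \<in> space M. X \<omega> = j} - measure N {\<omega> \<in> space N. Y \<omega> = j}\<bar>)"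
  unfolding tv_dist_def
proof (rule cSUP_least)
  fix A :: "nat set"
  show "\<bar>measure M {\<omega> \<in> space M. X \<omega> \<in> A} - measure N {\<omega> \<in> space N. Y \<omega> \<in> A}\<bar> \<le>
    (\<Sum>j. \<bar>measure M {\<omega> \<in> space M. X \<omega> = j} - measure N {\<omega> \<in> space N. Y \<omega> = j}\<bar>)"
    using expectation_diff_le_weighted_l1[OF M N X Y, of "indicator A" "\<lambda>_. 1"] sX sY
    unfolding prob_space.prob_eq_expectation_indicator[OF M] prob_space.prob_eq_expectation_indicator[OF N]
    by (simp add: indicator_def)
qed simp

text \<open>
  The supremum of a set of reals is meaningful only for a bounded set, and probabilities supply the
  bound.
\<close>
lemma tv_dist_nonneg:
  assumes "prob_space M" "prob_space N"
  shows "0 \<le> tv_dist M X N Y"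
proof -
  interpret M: prob_space M by fact
  interpret N: prob_space N by fact
  have "\<bar>measure M A - measure N B\<bar> \<le> 1" for A B
    using M.prob_le_1[of A] N.prob_le_1[of B] measure_nonneg[of M A] measure_nonneg[of N B]
    unfolding abs_le_iff by linarith
  then have "bdd_above (range (\<lambda>A. \<bar>measure M {\<omega> \<in> space M. X \<omega> \<in> A} - measure N {\<omega> \<in> space N. Y \<omega> \<in> A}\<bar>))"
    by (intro bdd_aboveI2)
  then show ?thesis
    unfolding tv_dist_def by (rule cSUP_upper2[where x = "{}"]) auto
qed

section \<open>Convergence under exponential domination\<close>

text \<open>
  The factor $j^r$ is absorbed into a larger base: $j^r \le r!\, e^j$ reduces the series to the
  exponential series at $e\,C$.
\<close>
lemma summable_power_mult_exp_term: "summable (\<lambda>j. real j ^ r * (C ^ j / fact j))" if "0 \<le> C" for C :: real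
proof (rule summable_comparison_test')
  have "summable (\<lambda>j. inverse (fact j) * (exp 1 * C) ^ j)"
    by (rule summable_exp)
  then show "summable (\<lambda>j. fact r * ((exp 1 * C) ^ j / fact j))"
    by (intro summable_mult) (simp add: field_simps)
  fix j :: nat
  \<comment> \<open>This says that the Poisson weight with parameter \<open>j\<close> at the point \<open>r\<close> is at most 1.\<close>
  have "real j ^ r \<le> fact r * exp (real j)"
    using poisson_weight_le_1[of "real j" r] by (simp add: poisson_weight_def exp_minus field_simps)
  then have "real j ^ r * (C ^ j / fact j) \<le> fact r * exp (real j) * (C ^ j / fact j)"
    using that by (intro mult_right_mono) auto
  also have "\<dots> = fact r * ((exp 1 * C) ^ j / fact j)"
    by (simp add: power_mult_distrib exp_of_nat_mult[symmetric])
  finally show "norm (real j ^ r * (C ^ j / fact j)) \<le> fact r * ((exp 1 * C) ^ j / fact j)"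
    using that by simp
qed

lemma weighted_l1_tendsto_0:
  fixes a :: "nat \<Rightarrow> nat \<Rightarrow> real"
  assumes lim: "\<And>j. (\<lambda>n. a n j) \<longlonglongrightarrow> b j"
    and nonneg: "\<And>n j. 0 \<le> a n j" and le: "\<And>n j. a n j \<le> g j"
    and summable: "summable (\<lambda>j. w j * g j)" and w: "\<And>j. 0 \<le> w j"
  shows "(\<lambda>n. \<Sum>j. w j * \<bar>a n j - b j\<bar>) \<longlonglongrightarrow> 0"
proof -
  \<comment> \<open>The limit obeys the same bounds, and two numbers in an interval \<open>{0..g}\<close> differ by at most \<open>g\<close>.\<close>
  have "0 \<le> b j" "b j \<le> g j" for j
    using LIMSEQ_le_const[OF lim] LIMSEQ_le_const2[OF lim] nonneg le by blast+
  then have ab: "\<bar>a n j - b j\<bar> \<le> g j" for n j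
    using nonneg[of n j] le[of n j] by (smt (verit))
  have "(\<lambda>n. \<Sum>j. w j * \<bar>a n j - b j\<bar>) \<longlonglongrightarrow> (\<Sum>j. 0)"
  proof (rule tannerys_theorem[THEN conjunct2, THEN conjunct2])
    show "(\<lambda>n. w j * \<bar>a n j - b j\<bar>) \<longlonglongrightarrow> 0" for j
      using tendsto_mult_left[OF tendsto_rabs_zero[OF LIM_zero[OF lim]], of "w j"] by simp
    show "\<forall>\<^sub>F (j, n) in at_top \<times>\<^sub>F sequentially. norm (w j * \<bar>a n j - b j\<bar>) \<le> w j * g j"
      by (intro always_eventually) (auto simp: abs_mult w intro!: mult_left_mono ab)
  qed (use summable in auto)
  then show ?thesis by simp
qed

section \<open>The Poisson limit of Bernoulli arrays\<close>

theorem corollary1p10: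
  fixes lam :: real
    and M :: "nat \<Rightarrow> 'a measure"
    and N :: "nat \<Rightarrow> nat"
    and B :: "nat \<Rightarrow> nat \<Rightarrow> 'a \<Rightarrow> nat"
    and p :: "nat \<Rightarrow> nat \<Rightarrow> real"
    and X :: "nat \<Rightarrow> 'a \<Rightarrow> nat"
    and \<theta> :: "nat \<Rightarrow> real"
  assumes lam_pos: "lam > 0"
    and prob: "\<And>n. prob_space (M n)"
    and indep: "\<And>n. prob_space.indep_vars (M n) (\<lambda>_. count_space UNIV) (B n) {1..N n}"
    and values01: "\<And>n k \<omega>. k \<in> {1..N n} \<Longrightarrow> \<omega> \<in> space (M n) \<Longrightarrow> B n k \<omega> \<in> {0, 1}"
    and success: "\<And>n k. k \<in> {1..N n} \<Longrightarrow> measure (M n) {\<omega> \<in> space (M n). B n k \<omega> = 1} = p n k"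
    and X_eq: "\<And>n \<omega>. X n \<omega> = (\<Sum>k = 1..N n. B n k \<omega>)"
    and \<theta>_eq: "\<And>n. \<theta> n = (\<integral>\<omega>. real (X n \<omega>) \<partial>M n)"
    and \<theta>_lim: "\<theta> \<longlonglongrightarrow> lam"
    and max_lim: "(\<lambda>n. Max (p n ` {1..N n})) \<longlonglongrightarrow> 0"
  shows "(\<forall>n. \<theta> n = (\<Sum>k = 1..N n. p n k)) \<and>
    (\<lambda>n. tv_dist (M n) (X n) (measure_pmf (poisson_pmf lam)) (\<lambda>j. j)) \<longlonglongrightarrow> 0 \<and>
    (\<forall>r\<in>{1..4::nat}. (\<lambda>n. \<integral>\<omega>. real (X n \<omega>) ^ r \<partial>M n)
        \<longlonglongrightarrow> measure_pmf.expectation (poisson_pmf lam) (\<lambda>j. real j ^ r))"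
proof -
  let ?P = "measure_pmf (poisson_pmf lam)"
  let ?a = "\<lambda>n j. measure (M n) {\<omega> \<in> space (M n). X n \<omega> = j}"
  have B_meas: "B n k \<in> M n \<rightarrow>\<^sub>M count_space UNIV" if "k \<in> {1..N n}" for n k
    using indep[of n] that prob[of n] by (simp add: prob_space.indep_vars_def)
  have X_meas: "X n \<in> M n \<rightarrow>\<^sub>M count_space UNIV" for n
    unfolding X_eq by (rule measurable_sum_nat) (rule B_meas)
  have mean: "\<theta> n = (\<Sum>k = 1..N n. p n k)" for n
    unfolding \<theta>_eq X_eq
    by (rule prob_space.bernoulli_sum_mean[OF prob B_meas values01 success])
  have p_nonneg: "0 \<le> p n k" if "k \<in> {1..N n}" for n k
    using success[OF that] by (metis measure_nonneg)
  have \<theta>_nonneg: "0 \<le> \<theta> n" for n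
    unfolding mean by (intro sum_nonneg p_nonneg)
  obtain C where C: "\<theta> n \<le> C" for n
    using Bseq_bdd_above[OF convergent_imp_Bseq[OF convergentI[OF \<theta>_lim]]]
    by (auto simp: bdd_above_def)
  then have C_nonneg: "0 \<le> C"
    using \<theta>_nonneg order_trans by blast
  have near: "\<bar>?a n j - poisson_weight (\<theta> n) j\<bar> \<le> 2 * (\<Sum>k = 1..N n. (p n k)\<^sup>2)" for n j
    unfolding X_eq mean
    by (rule prob_space.bernoulli_sum_prob_near_poisson[OF prob _ indep values01 success]) auto
  have a_le: "?a n j \<le> C ^ j / fact j" for n j
  proof -
    have "?a n j \<le> \<theta> n ^ j / fact j"
      unfolding X_eq mean
      by (rule prob_space.bernoulli_sum_prob_le[OF prob _ indep values01 success]) auto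
    also have "\<dots> \<le> C ^ j / fact j"
      by (intro divide_right_mono power_mono C \<theta>_nonneg) simp
    finally show ?thesis .
  qed
  \<comment> \<open>If \<open>N n = 0\<close>, the maximum is unspecified, but both sides are 0.\<close>
  have sq_le: "(\<Sum>k = 1..N n. (p n k)\<^sup>2) \<le> Max (p n ` {1..N n}) * \<theta> n" for n
    unfolding mean sum_distrib_left power2_eq_square
    by (intro sum_mono mult_right_mono p_nonneg Max_ge) auto
  have "(\<lambda>n. Max (p n ` {1..N n}) * \<theta> n) \<longlonglongrightarrow> 0"
    using tendsto_mult[OF max_lim \<theta>_lim] by simp
  then have sq: "(\<lambda>n. \<Sum>k = 1..N n. (p n k)\<^sup>2) \<longlonglongrightarrow> 0"
    by (rule Lim_null_comparison[OF always_eventually, rotated])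
      (auto simp: sum_nonneg intro: sq_le simp del: One_nat_def)
  have a_lim: "(\<lambda>n. ?a n j) \<longlonglongrightarrow> poisson_weight lam j" for j
  proof -
    have "(\<lambda>n. ?a n j - poisson_weight (\<theta> n) j) \<longlonglongrightarrow> 0"
      using near
      by (intro Lim_null_comparison[OF always_eventually tendsto_mult_right_zero[OF sq, of 2]])
        (simp del: One_nat_def)
    moreover have "(\<lambda>n. poisson_weight (\<theta> n) j) \<longlonglongrightarrow> poisson_weight lam j"
      unfolding poisson_weight_def by (intro tendsto_intros \<theta>_lim) simp
    ultimately show ?thesis
      using tendsto_add by fastforce
  qed
  have b_eq: "measure ?P {j} = poisson_weight lam j" for j
    using pmf_poisson_eq_weight[OF lam_pos, of j] by (simp add: pmf.rep_eq)
  have b_le: "poisson_weight lam j \<le> C ^ j / fact j" for j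
    by (rule LIMSEQ_le_const2[OF a_lim]) (use a_le in blast)
  have summable_C: "summable (\<lambda>j. real j ^ r * (C ^ j / fact j))" for r
    by (rule summable_power_mult_exp_term[OF C_nonneg])
  have sa: "summable (\<lambda>j. real j ^ r * ?a n j)" for r n
    by (rule summable_comparison_test'[OF summable_C[of r]])
      (simp add: abs_mult mult_left_mono a_le del: times_divide_eq_right)
  have sb: "summable (\<lambda>j. real j ^ r * poisson_weight lam j)" for r
    using lam_pos
    by (intro summable_comparison_test'[OF summable_C[of r]])
      (simp add: abs_mult mult_left_mono b_le poisson_weight_nonneg del: times_divide_eq_right)
  have l1: "(\<lambda>n. \<Sum>j. real j ^ r * \<bar>?a n j - poisson_weight lam j\<bar>) \<longlonglongrightarrow> 0" for r
    by (rule weighted_l1_tendsto_0[OF a_lim _ a_le summable_C]) auto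
  \<comment> \<open>The factor \<open>real j ^ 0\<close> is 1 also at \<open>j = 0\<close>.\<close>
  have tv_le: "tv_dist (M n) (X n) ?P (\<lambda>j. j) \<le> (\<Sum>j. real j ^ 0 * \<bar>?a n j - poisson_weight lam j\<bar>)" for n
    using tv_dist_le_l1[OF prob[of n] prob_space_measure_pmf[of "poisson_pmf lam"] X_meas[of n], of "\<lambda>j. j"]
      sa[of 0 n] sb[of 0]
    by (simp add: b_eq)
  have tv: "(\<lambda>n. tv_dist (M n) (X n) ?P (\<lambda>j. j)) \<longlonglongrightarrow> 0"
  proof (rule Lim_null_comparison[OF always_eventually l1[of 0]], rule allI)
    show "norm (tv_dist (M n) (X n) ?P (\<lambda>j. j))
        \<le> (\<Sum>j. real j ^ 0 * \<bar>?a n j - poisson_weight lam j\<bar>)" for n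
      using tv_le[of n] tv_dist_nonneg[OF prob[of n] prob_space_measure_pmf[of "poisson_pmf lam"]]
      by simp
  qed
  have moments: "(\<lambda>n. \<integral>\<omega>. real (X n \<omega>) ^ r \<partial>M n)
      \<longlonglongrightarrow> measure_pmf.expectation (poisson_pmf lam) (\<lambda>j. real j ^ r)" for r
  proof (rule LIM_zero_cancel, rule Lim_null_comparison[OF always_eventually l1[of r]], rule allI)
    fix n
    show "norm ((\<integral>\<omega>. real (X n \<omega>) ^ r \<partial>M n) - measure_pmf.expectation (poisson_pmf lam) (\<lambda>j. real j ^ r))
        \<le> (\<Sum>j. real j ^ r * \<bar>?a n j - poisson_weight lam j\<bar>)"
      using expectation_diff_le_weighted_l1[OF prob[of n] prob_space_measure_pmf[of "poisson_pmf lam"]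
          X_meas[of n], of "\<lambda>j. j" "\<lambda>j. real j ^ r" "\<lambda>j. real j ^ r"] sa[of r n] sb[of r]
      by (simp add: b_eq)
  qed
  show ?thesis
    using mean tv moments by blast
qed

end
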